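(* Fix $s\in\mathbb N$. For each $n\in\mathbb N$, let $G_n=(V_n=[n],\Phi_n,E_n)$ be a factor graph such that $\max_{x\in V_n}|E[x]|\le\Delta$ and $\max_{\phi\in\Phi_n}|S[\phi]|\le\kappa$ with $\Delta,\kappa<\infty$ independent of $n$. Let $\mu^{(n)}(\sigma)\propto\exp\left(\sum_{\phi\in\Phi_n}\phi(\sigma)\right)$ and $\nu^{(n)}(\sigma)\propto\exp\left(\sum_{\phi\in\Phi_n}\phi(\sigma)+g^{(n)}(\sigma)\right)$ on $\Omega_n=[s]^n$, where $g^{(n)}=\sum_{\phi\in\Phi_n}g^{(n)}_\phi$ and each $g^{(n)}_\phi:\Omega_n\to\mathbb R$ depends only on the coordinates in $S[\phi]$. Write $\delta^{(n)}_\phi=\frac12\left(\sup_{\Omega_n}g_\phi^{(n)}-\inf_{\Omega_n}g_\phi^{(n)}\right)$. Suppose there is a constant $C_{\mathrm{AT}}<\infty$, independent of $n$, such that for every $n$ and every $f:\Omega_n\to[0,\infty)$, $$\mathrm{Ent}_{V_n}(f)\le C_{\mathrm{AT}}\sum_{x\in V_n}\mu^{(n)}\bigl(\mathrm{Ent}_{\{x\}}f\bigr),$$ where the entropies are taken with respect to $\mu^{(n)}$. If $$\sum_{\phi\in\Phi_n}\bigl(\delta^{(n)}_\phi\bigr)^2\longrightarrow0\qquad(n\to\infty),$$ then $d_{\mathrm H}(\nu^{(n)},\mu^{(n)})\to0$. In particular, the displayed convergence $\sum_{\phi\in\Phi_n}(\delta_\phi^{(n)})^2\to0$ holds if $\m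ax_{\phi\in\Phi_n}\delta^{(n)}_\phi=o(n^{-1/2})$.
   Context: $[s]=\{1,\dots,s\}$. A factor graph $G=(V,\Phi,E)$ consists of a finite set $V$ (vertices), a set $E$ of unordered pairs of distinct vertices (edges), and a finite indexed collection $\Phi$ of functions $\phi:[s]^V\to\mathbb R$ (factors); each $\phi\in\Phi$ comes with a nonempty declared scope $S[\phi]\subseteq V$ and depends only on the coordinates in $S[\phi]$. For $x\in V$, $E[x]=\{\phi\in\Phi:x\in S[\phi]\}$. $d_{\mathrm H}(\nu,\mu)=\left(\sum_\sigma(\sqrt{\nu(\sigma)}-\sqrt{\mu(\sigma)})^2\right)^{1/2}$. For a full-support probability measure $\mu$ on $[s]^V$, $A\subseteq V$ and $\tau_{A^c}\in[s]^{A^c}$, $\mu_A^{\tau_{A^c}}$ is the conditional law of $\sigma_A$ under $\mu$ given $\sigma_{A^c}=\tau_{A^c}$. For $f\ge0$, $\mu_A^{\tau_{A^c}}(f)$ is the expectation of $f(\sigma_A\tau_{A^c})$ with $\sigma_A\sim\mu_A^{\tau_{A^c}}$, $(\mathrm{Ent}_Af)(\tau_{A^c})=\mu_A^{\tau_{A^c}}\left[f\log\left(f/\mu_A^{\tau_{A^c}}(f)\right)\right]$ (with $0\log0=0$), $\mu(\mathrm{Ent}_Af)$ is its expectation under $\mu$, and $\mathrm{Ent}_V(f)=\mu\left[f\log(f/\mu(f))\right]$. *)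

theory Defs
  imports "HOL-Probability.Probability" "HOL-Library.Landau_Symbols"
begin

definition configs :: "nat \<Rightarrow> 'v set \<Rightarrow> ('v \<Rightarrow> nat) set" where
  "configs s V = PiE V (\<lambda>_. {1..s})"

definition depends_only_on :: "nat \<Rightarrow> 'v set \<Rightarrow> 'v set \<Rightarrow> (('v \<Rightarrow> nat) \<Rightarrow> real) \<Rightarrow> bool" where
  "depends_only_on s V S h \<longleftrightarrow>
     (\<forall>\<sigma> \<in> configs s V. \<forall>\<tau> \<in> configs s V. (\<forall>x\<in>S. \<sigma> x = \<tau> x) \<longrightarrow> h \<sigma> = h \<tau>)"

(* The collection of factors is indexed by the set "indices", so that the same function
   may occur several times, possibly with different declared scopes. Factors are total
   functions of which only the values on configs s (verts G) matter. *)
record ('v, 'i) factor_graph =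
  verts :: "'v set"
  indices :: "'i set"
  factor :: "'i \<Rightarrow> ('v \<Rightarrow> nat) \<Rightarrow> real"
  scope :: "'i \<Rightarrow> 'v set"
  edges :: "'v set set"

definition wf_factor_graph :: "nat \<Rightarrow> ('v, 'i) factor_graph \<Rightarrow> bool" where
  "wf_factor_graph s G \<longleftrightarrow>
     finite (verts G) \<and>
     (\<forall>e \<in> edges G. e \<subseteq> verts G \<and> card e = 2) \<and>
     finite (indices G) \<and>
     (\<forall>i \<in> indices G. scope G i \<noteq> {} \<and> scope G i \<subseteq> verts G \<and>
        depends_only_on s (verts G) (scope G i) (factor G i))"

definition factors_at :: "('v, 'i) factor_graph \<Rightarrow> 'v \<Rightarrow> 'i set" where
  "factors_at G x = {i \<in> indices G. x \<in> scope G i}"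

(* Only meaningful for finite V and s \<ge> 1; see pmf_gibbs below. *)
definition gibbs :: "nat \<Rightarrow> 'v set \<Rightarrow> (('v \<Rightarrow> nat) \<Rightarrow> real) \<Rightarrow> ('v \<Rightarrow> nat) pmf" where
  "gibbs s V H = embed_pmf (\<lambda>\<sigma>. if \<sigma> \<in> configs s V
     then exp (H \<sigma>) / (\<Sum>\<tau> \<in> configs s V. exp (H \<tau>)) else 0)"

definition hellinger_dist :: "'a set \<Rightarrow> 'a pmf \<Rightarrow> 'a pmf \<Rightarrow> real" where
  "hellinger_dist \<Omega> \<nu> \<mu> = sqrt (\<Sum>\<sigma> \<in> \<Omega>. (sqrt (pmf \<nu> \<sigma>) - sqrt (pmf \<mu> \<sigma>))\<^sup>2)"

(* Where f vanishes, the integrand is 0 * ln 0 = 0, as the usual convention demands. *)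
definition entropy_pmf :: "'a pmf \<Rightarrow> ('a \<Rightarrow> real) \<Rightarrow> real" where
  "entropy_pmf \<mu> f = measure_pmf.expectation \<mu>
     (\<lambda>\<sigma>. f \<sigma> * ln (f \<sigma> / measure_pmf.expectation \<mu> f))"

(* The law of the restriction of \<sigma> to A, given that \<sigma> agrees with \<tau> on V - A. *)
definition cond_law :: "'v set \<Rightarrow> ('v \<Rightarrow> nat) pmf \<Rightarrow> 'v set \<Rightarrow> ('v \<Rightarrow> nat) \<Rightarrow> ('v \<Rightarrow> nat) pmf" where
  "cond_law V \<mu> A \<tau> =
     map_pmf (\<lambda>\<sigma>. restrict \<sigma> A) (cond_pmf \<mu> {\<sigma>. restrict \<sigma> (V - A) = \<tau>})"

(* override_on \<tau> \<eta> A is the concatenation of \<eta> on A and \<tau> on V - A. *)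
definition local_entropy ::
  "'v set \<Rightarrow> ('v \<Rightarrow> nat) pmf \<Rightarrow> 'v set \<Rightarrow> (('v \<Rightarrow> nat) \<Rightarrow> real) \<Rightarrow> ('v \<Rightarrow> nat) \<Rightarrow> real" where
  "local_entropy V \<mu> A f \<tau> = entropy_pmf (cond_law V \<mu> A \<tau>) (\<lambda>\<eta>. f (override_on \<tau> \<eta> A))"

definition mean_local_entropy ::
  "'v set \<Rightarrow> ('v \<Rightarrow> nat) pmf \<Rightarrow> 'v set \<Rightarrow> (('v \<Rightarrow> nat) \<Rightarrow> real) \<Rightarrow> real" where
  "mean_local_entropy V \<mu> A f =
     measure_pmf.expectation \<mu> (\<lambda>\<sigma>. local_entropy V \<mu> A f (restrict \<sigma> (V - A)))"

definition half_osc :: "'a set \<Rightarrow> ('a \<Rightarrow> real) \<Rightarrow> real" where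
  "half_osc \<Omega> h = ((SUP \<sigma>\<in>\<Omega>. h \<sigma>) - (INF \<sigma>\<in>\<Omega>. h \<sigma>)) / 2"

lemma finite_configs: "finite V \<Longrightarrow> finite (configs s V)"
  by (simp add: configs_def finite_PiE)

lemma configs_nonempty: "s \<ge> 1 \<Longrightarrow> configs s V \<noteq> {}"
  by (simp add: configs_def PiE_eq_empty_iff)

lemma pmf_gibbs:
  assumes "finite V" "s \<ge> 1"
  shows "pmf (gibbs s V H) \<sigma> = (if \<sigma> \<in> configs s V
     then exp (H \<sigma>) / (\<Sum>\<tau> \<in> configs s V. exp (H \<tau>)) else 0)"
proof -
  let ?Z = "\<Sum>\<tau> \<in> configs s V. exp (H \<tau>)"
  let ?w = "\<lambda>\<sigma>. if \<sigma> \<in> configs s V then exp (H \<sigma>) / ?Z else 0"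
  have fin: "finite (configs s V)" using assms(1) by (rule finite_configs)
  have Z: "?Z > 0" using fin configs_nonempty[OF assms(2)] by (intro sum_pos) auto
  have nonneg: "?w \<tau> \<ge> 0" for \<tau> using Z by simp
  have "(\<integral>\<^sup>+\<tau>. ennreal (?w \<tau>) \<partial>count_space UNIV)
      = (\<integral>\<^sup>+\<tau>. ennreal (?w \<tau>) * indicator (configs s V) \<tau> \<partial>count_space UNIV)"
    by (intro nn_integral_cong) (auto split: split_indicator)
  also have "\<dots> = (\<integral>\<^sup>+\<tau>. ennreal (?w \<tau>) \<partial>count_space (configs s V))"
    by (simp add: nn_integral_count_space_indicator)
  also have "\<dots> = (\<Sum>\<tau> \<in> configs s V. ennreal (?w \<tau>))"
    using fin by (rule nn_integral_count_space_finite)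
  also have "\<dots> = ennreal (\<Sum>\<tau> \<in> configs s V. ?w \<tau>)"
    by (rule sum_ennreal) (rule nonneg)
  also have "(\<Sum>\<tau> \<in> configs s V. ?w \<tau>) = 1"
    using Z by (simp add: sum_divide_distrib[symmetric])
  finally show ?thesis
    unfolding gibbs_def using nonneg by (subst pmf_embed_pmf) auto
qed

end

theory Submission
  imports Defs
begin

text \<open>
  The density \<open>F = d\<nu>/d\<mu>\<close> satisfies \<open>d\<^sub>H(\<nu>, \<mu>)\<^sup>2 \<le> Ent(F)\<close>, and by tensorization \<open>Ent(F)\<close> is at most
  \<open>C\<^sub>A\<^sub>T\<close> times a sum of single-site entropies. Resampling the site \<open>x\<close> changes \<open>ln F\<close> by at most
  \<open>a x = 2 \<Sum> \<delta> \<phi>\<close>, the sum ranging over the at most \<open>\<Delta>\<close> factors at \<open>x\<close>; so the single-site entropy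
  at a configuration \<open>\<sigma>\<close> is at most \<open>F \<sigma> exp (a x) (a x)\<^sup>2\<close>, where \<open>F\<close> has mean one. Cauchy-Schwarz
  and double counting bound \<open>\<Sum> (a x)\<^sup>2\<close> by \<open>4 \<Delta> \<kappa> \<Sum> (\<delta> \<phi>)\<^sup>2\<close>.
\<close>

section \<open>Entropy of a positive function whose logarithm oscillates little\<close>

text \<open>With \<open>m\<close> the mean of \<open>f\<close>, the inequality
  \<open>ln u \<le> u - 1\<close> places \<open>f x * ln (f x / m) - f x + m\<close> between 0 and
  \<open>(f x - m) * ln (f x / m)\<close>. Both factors of this product are of first order in
  \<open>a\<close>, hence the square. This quadratic rate is what makes the sum of the squared
  oscillations the relevant quantity later.\<close>

lemma entropy_pmf_le:
  fixes p :: "'a pmf"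
  assumes fin: "finite (set_pmf p)"
    and pos: "\<And>x. x \<in> set_pmf p \<Longrightarrow> f x > 0"
    and osc: "\<And>x y. x \<in> set_pmf p \<Longrightarrow> y \<in> set_pmf p \<Longrightarrow> \<bar>ln (f x) - ln (f y)\<bar> \<le> a"
    and c: "\<And>x. x \<in> set_pmf p \<Longrightarrow> f x \<le> c"
  shows "0 \<le> entropy_pmf p f" and "entropy_pmf p f \<le> c * a\<^sup>2"
proof -
  let ?E = "measure_pmf.expectation p"
  have int: "integrable p h" for h :: "'a \<Rightarrow> real"
    using fin by (rule integrable_measure_pmf_finite)
  define m where "m = ?E f"
  have AE_iff: "(AE x in p. P x) \<longleftrightarrow> (\<forall>x\<in>set_pmf p. P x)" for P
    by (rule AE_measure_pmf_iff)
  have lower: "b \<le> m" if "\<And>x. x \<in> set_pmf p \<Longrightarrow> b \<le> f x" for b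
    unfolding m_def using that by (intro measure_pmf.integral_ge_const int) (auto simp: AE_iff)
  have upper: "m \<le> b" if "\<And>x. x \<in> set_pmf p \<Longrightarrow> f x \<le> b" for b
    unfolding m_def using that by (intro measure_pmf.integral_le_const int) (auto simp: AE_iff)
  \<comment> \<open>Any two values of \<open>f\<close> on the support differ by a factor of at most
    \<open>exp a\<close>. Averaging over one of the two points carries this over to
    \<open>m\<close>, which yields first \<open>m_pos\<close> and then \<open>log\<close>.\<close>
  have range: "f y * exp (- a) \<le> f x" "f x \<le> f y * exp a" if "x \<in> set_pmf p" "y \<in> set_pmf p" for x y
  proof -
    have "exp (ln (f x)) \<le> exp (ln (f y) + a)" "exp (ln (f y) + - a) \<le> exp (ln (f x))"
      using osc[OF that] by (simp_all add: abs_le_iff)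
    then show "f y * exp (- a) \<le> f x" "f x \<le> f y * exp a"
      using pos that by (simp_all only: exp_add exp_ln)
  qed
  have m_pos: "m > 0"
  proof -
    obtain y where y: "y \<in> set_pmf p" using set_pmf_not_empty[of p] by blast
    have "0 < f y * exp (- a)" using pos[OF y] by simp
    also have "\<dots> \<le> m" using range y by (intro lower) auto
    finally show ?thesis .
  qed
  have m_le: "m \<le> c" using c by (rule upper)
  have log: "\<bar>ln (f x / m)\<bar> \<le> a" if x: "x \<in> set_pmf p" for x
  proof -
    have "f x * exp (- a) \<le> m" "m \<le> f x * exp a"
      using range x by (auto intro!: lower upper)
    then have "ln (f x * exp (- a)) \<le> ln m" "ln m \<le> ln (f x * exp a)"
      using m_pos pos[OF x] by simp_all
    then show ?thesis
      using m_pos pos[OF x] by (simp add: ln_mult ln_div abs_le_iff)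
  qed
  \<comment> \<open>The added terms have mean zero and make the integrand pointwise nonnegative.\<close>
  have entropy_eq: "entropy_pmf p f = ?E (\<lambda>x. f x * ln (f x / m) - f x + m)"
    using int by (simp add: entropy_pmf_def m_def[symmetric])
  have pointwise: "0 \<le> f x * ln (f x / m) - f x + m \<and> f x * ln (f x / m) - f x + m \<le> c * a\<^sup>2"
    if x: "x \<in> set_pmf p" for x
  proof
    have fx: "f x > 0" using pos[OF x] .
    have inv: "1 - m / f x \<le> ln (f x / m)"
      using ln_le_minus_one[of "m / f x"] fx m_pos by (simp add: ln_div)
    have "f x * (1 - m / f x) \<le> f x * ln (f x / m)"
      using inv fx by (intro mult_left_mono) auto
    then show "0 \<le> f x * ln (f x / m) - f x + m"
      using fx by (simp add: right_diff_distrib)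
    have dir: "ln (f x / m) \<le> f x / m - 1"
      using fx m_pos by (intro ln_le_minus_one) auto
    \<comment> \<open>Here and in \<open>dnd\<close>: the logarithmic mean value estimate
      \<open>\<bar>u - v\<bar> \<le> max u v * \<bar>ln u - ln v\<bar>\<close> for
      \<open>f x\<close> and \<open>m\<close>, one sign at a time. The constant \<open>c\<close>
      dominates both values.\<close>
    have upd: "f x - m \<le> c * \<bar>ln (f x / m)\<bar>"
    proof -
      have "f x * (1 - m / f x) \<le> f x * \<bar>ln (f x / m)\<bar>"
        using inv fx by (intro mult_left_mono) auto
      also have "\<dots> \<le> c * \<bar>ln (f x / m)\<bar>" using c[OF x] by (intro mult_right_mono) auto
      finally show ?thesis using fx by (simp add: right_diff_distrib)
    qed
    have dnd: "m - f x \<le> c * \<bar>ln (f x / m)\<bar>"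
    proof -
      have "m * (1 - f x / m) \<le> m * \<bar>ln (f x / m)\<bar>"
        using dir m_pos by (intro mult_left_mono) auto
      also have "\<dots> \<le> c * \<bar>ln (f x / m)\<bar>" using m_le by (intro mult_right_mono) auto
      finally show ?thesis using m_pos by (simp add: right_diff_distrib)
    qed
    have "m * ln (f x / m) \<le> m * (f x / m - 1)"
      using dir m_pos by (intro mult_left_mono) auto
    then have "f x * ln (f x / m) - f x + m \<le> (f x - m) * ln (f x / m)"
      using m_pos by (simp add: right_diff_distrib left_diff_distrib)
    also have "\<dots> \<le> \<bar>f x - m\<bar> * \<bar>ln (f x / m)\<bar>"
      by (metis abs_ge_self abs_mult)
    also have "\<dots> \<le> (c * \<bar>ln (f x / m)\<bar>) * \<bar>ln (f x / m)\<bar>"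
      using upd dnd by (intro mult_right_mono) auto
    also have "\<dots> = c * \<bar>ln (f x / m)\<bar>\<^sup>2" by (simp add: power2_eq_square)
    also have "\<dots> \<le> c * a\<^sup>2"
      using log[OF x] m_le m_pos by (intro mult_left_mono power_mono) auto
    finally show "f x * ln (f x / m) - f x + m \<le> c * a\<^sup>2" .
  qed
  show "0 \<le> entropy_pmf p f"
    unfolding entropy_eq using pointwise
    by (intro measure_pmf.integral_ge_const int) (auto simp: AE_iff)
  show "entropy_pmf p f \<le> c * a\<^sup>2"
    unfolding entropy_eq using pointwise
    by (intro measure_pmf.integral_le_const int) (auto simp: AE_iff)
qed

section \<open>Conditional entropies and their averages\<close>

text \<open>Gluing a point of the support of the conditional law to the boundary condition gives
  back a configuration in the support of \<mu> that agrees with \<sigma> off \<open>A\<close>, so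
  \<open>entropy_pmf_le\<close> applies. Comparing with \<sigma> itself allows
  \<open>c = f \<sigma> * exp a\<close>; unlike a global supremum of \<open>f\<close>, this bound
  averages to a multiple of the mean of \<open>f\<close>.\<close>

lemma local_entropy_le:
  assumes V: "finite V" and A: "A \<subseteq> V" and \<mu>: "set_pmf \<mu> \<subseteq> configs s V"
    and \<sigma>: "\<sigma> \<in> set_pmf \<mu>"
    and pos: "\<And>\<sigma>. \<sigma> \<in> set_pmf \<mu> \<Longrightarrow> f \<sigma> > 0"
    and osc: "\<And>\<sigma> \<tau>. \<sigma> \<in> set_pmf \<mu> \<Longrightarrow> \<tau> \<in> set_pmf \<mu> \<Longrightarrow> (\<And>x. x \<notin> A \<Longrightarrow> \<sigma> x = \<tau> x) \<Longrightarrow>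
                \<bar>ln (f \<sigma>) - ln (f \<tau>)\<bar> \<le> a"
  shows "0 \<le> local_entropy V \<mu> A f (restrict \<sigma> (V - A))"
    and "local_entropy V \<mu> A f (restrict \<sigma> (V - A)) \<le> f \<sigma> * exp a * a\<^sup>2"
proof -
  let ?\<tau> = "restrict \<sigma> (V - A)"
  let ?S = "{\<sigma>'. restrict \<sigma>' (V - A) = ?\<tau>}"
  let ?p = "cond_law V \<mu> A ?\<tau>"
  let ?f = "\<lambda>\<eta>. f (override_on ?\<tau> \<eta> A)"
  \<comment> \<open>Conditioning is meaningful only on an event that meets the support; \<sigma> is
    the witness.\<close>
  have "set_pmf \<mu> \<inter> ?S \<noteq> {}" using \<sigma> by auto
  then have set: "set_pmf ?p = (\<lambda>\<sigma>'. restrict \<sigma>' A) ` (set_pmf \<mu> \<inter> ?S)"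
    by (simp add: cond_law_def set_cond_pmf)
  have glue: "override_on ?\<tau> (restrict \<sigma>' A) A = \<sigma>'" if "\<sigma>' \<in> set_pmf \<mu> \<inter> ?S" for \<sigma>'
  proof
    fix x
    have tau: "restrict \<sigma>' (V - A) = ?\<tau>" and "\<sigma>' \<in> PiE V (\<lambda>_. {1..s})"
      using that \<mu> by (auto simp: configs_def)
    \<comment> \<open>Outside \<open>V\<close> the glued function is \<open>undefined\<close>, and
      so is every element of \<open>PiE\<close>; thus equality holds on the whole type and not only
      on \<open>V\<close>.\<close>
    note undef = PiE_arb[OF this(2), of x]
    show "override_on ?\<tau> (restrict \<sigma>' A) A x = \<sigma>' x"
      unfolding tau[symmetric] override_on_def using A undef by auto
  qed
  have off: "\<sigma>1 x = \<sigma>2 x"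
    if "\<sigma>1 \<in> set_pmf \<mu> \<inter> ?S" "\<sigma>2 \<in> set_pmf \<mu> \<inter> ?S" "x \<notin> A" for \<sigma>1 \<sigma>2 x
    using glue[OF that(1)] glue[OF that(2)] that(3) by (metis override_on_apply_notin)
  have fin: "finite (set_pmf ?p)"
    unfolding set using \<mu> finite_configs[OF V] by (auto intro: finite_subset)
  have rep: "\<exists>\<sigma>'\<in>set_pmf \<mu> \<inter> ?S. ?f \<eta> = f \<sigma>'" if "\<eta> \<in> set_pmf ?p" for \<eta>
    using that glue unfolding set by fastforce
  have osc': "\<bar>ln (?f \<eta>) - ln (?f \<zeta>)\<bar> \<le> a" if \<eta>: "\<eta> \<in> set_pmf ?p" and \<zeta>: "\<zeta> \<in> set_pmf ?p" for \<eta> \<zeta>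
  proof -
    obtain \<sigma>1 where s1: "\<sigma>1 \<in> set_pmf \<mu> \<inter> ?S" "?f \<eta> = f \<sigma>1"
      using rep[OF \<eta>] by (rule bexE)
    obtain \<sigma>2 where s2: "\<sigma>2 \<in> set_pmf \<mu> \<inter> ?S" "?f \<zeta> = f \<sigma>2"
      using rep[OF \<zeta>] by (rule bexE)
    have "\<bar>ln (f \<sigma>1) - ln (f \<sigma>2)\<bar> \<le> a"
      using s1(1) s2(1) by (intro osc off[OF s1(1) s2(1)]) auto
    then show ?thesis by (simp only: s1(2) s2(2))
  qed
  have le: "?f \<eta> \<le> f \<sigma> * exp a" if \<eta>: "\<eta> \<in> set_pmf ?p" for \<eta>
  proof -
    obtain \<sigma>1 where s1: "\<sigma>1 \<in> set_pmf \<mu> \<inter> ?S" "?f \<eta> = f \<sigma>1"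
      using rep[OF \<eta>] by (rule bexE)
    have s2: "\<sigma> \<in> set_pmf \<mu> \<inter> ?S" using \<sigma> by auto
    have "\<bar>ln (f \<sigma>1) - ln (f \<sigma>)\<bar> \<le> a"
      using s1(1) \<sigma> by (intro osc off[OF s1(1) s2]) auto
    then have "exp (ln (f \<sigma>1)) \<le> exp (ln (f \<sigma>) + a)" by simp
    then show ?thesis using pos[OF \<sigma>] pos[of \<sigma>1] s1 by (simp add: exp_add)
  qed
  have pos': "?f \<eta> > 0" if "\<eta> \<in> set_pmf ?p" for \<eta>
    using rep[OF that] pos by auto
  show "0 \<le> local_entropy V \<mu> A f ?\<tau>" "local_entropy V \<mu> A f ?\<tau> \<le> f \<sigma> * exp a * a\<^sup>2"
    unfolding local_entropy_def
    by (rule entropy_pmf_le[OF fin]; fact pos' osc' le)+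
qed

lemma mean_local_entropy_le:
  assumes V: "finite V" and A: "A \<subseteq> V" and \<mu>: "set_pmf \<mu> \<subseteq> configs s V"
    and pos: "\<And>\<sigma>. \<sigma> \<in> set_pmf \<mu> \<Longrightarrow> f \<sigma> > 0"
    and osc: "\<And>\<sigma> \<tau>. \<sigma> \<in> set_pmf \<mu> \<Longrightarrow> \<tau> \<in> set_pmf \<mu> \<Longrightarrow> (\<And>x. x \<notin> A \<Longrightarrow> \<sigma> x = \<tau> x) \<Longrightarrow>
                \<bar>ln (f \<sigma>) - ln (f \<tau>)\<bar> \<le> a"
  shows "0 \<le> mean_local_entropy V \<mu> A f"
    and "mean_local_entropy V \<mu> A f \<le> measure_pmf.expectation \<mu> f * exp a * a\<^sup>2"
proof -
  have int: "integrable \<mu> h" for h :: "_ \<Rightarrow> real"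
    using \<mu> finite_configs[OF V] by (intro integrable_measure_pmf_finite) (rule finite_subset)
  have local: "0 \<le> local_entropy V \<mu> A f (restrict \<sigma> (V - A))"
    "local_entropy V \<mu> A f (restrict \<sigma> (V - A)) \<le> f \<sigma> * exp a * a\<^sup>2"
    if "\<sigma> \<in> set_pmf \<mu>" for \<sigma>
    by (rule local_entropy_le[OF V A \<mu> that]; fact pos osc)+
  show "0 \<le> mean_local_entropy V \<mu> A f"
    unfolding mean_local_entropy_def using local(1)
    by (intro integral_nonneg_AE) (simp add: AE_measure_pmf_iff)
  have "mean_local_entropy V \<mu> A f \<le> measure_pmf.expectation \<mu> (\<lambda>\<sigma>. f \<sigma> * exp a * a\<^sup>2)"
    unfolding mean_local_entropy_def using local(2)
    by (intro integral_mono_AE int) (simp add: AE_measure_pmf_iff)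
  then show "mean_local_entropy V \<mu> A f \<le> measure_pmf.expectation \<mu> f * exp a * a\<^sup>2"
    by simp
qed

section \<open>Hellinger distance and the entropy of a density\<close>

lemma expectation_density:
  assumes "finite \<Omega>" "set_pmf \<mu> = \<Omega>" "set_pmf \<nu> \<subseteq> \<Omega>"
  shows "measure_pmf.expectation \<mu> (\<lambda>\<sigma>. pmf \<nu> \<sigma> / pmf \<mu> \<sigma>) = 1"
proof -
  have "measure_pmf.expectation \<mu> (\<lambda>\<sigma>. pmf \<nu> \<sigma> / pmf \<mu> \<sigma>)
      = (\<Sum>\<sigma>\<in>\<Omega>. pmf \<nu> \<sigma> / pmf \<mu> \<sigma> * pmf \<mu> \<sigma>)"
    using assms by (intro integral_measure_pmf_real) auto
  also have "\<dots> = (\<Sum>\<sigma>\<in>\<Omega>. pmf \<nu> \<sigma>)"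
    using assms by (intro sum.cong) (auto simp: set_pmf_iff)
  also have "\<dots> = 1" using assms by (intro sum_pmf_eq_1) auto
  finally show ?thesis .
qed

text \<open>The bound holds term by term once \<open>- q + p\<close> is added to the entropy
  integrand. These corrections cancel in the sum, because both measures have total mass one.\<close>

lemma hellinger_dist_le_entropy:
  assumes fin: "finite \<Omega>" and \<mu>: "set_pmf \<mu> = \<Omega>" and \<nu>: "set_pmf \<nu> \<subseteq> \<Omega>"
  shows "hellinger_dist \<Omega> \<nu> \<mu> \<le> sqrt (entropy_pmf \<mu> (\<lambda>\<sigma>. pmf \<nu> \<sigma> / pmf \<mu> \<sigma>))"
proof -
  have pointwise: "(sqrt q - sqrt p)\<^sup>2 \<le> q / p * ln (q / p) * p - q + p"
    if "p > 0" "q \<ge> 0" for p q :: real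
  proof (cases "q = 0")
    case False
    then have q: "q > 0" using that by simp
    \<comment> \<open>Taking \<open>ln u \<le> u - 1\<close> at the square root of
      \<open>p / q\<close> produces the cross term \<open>2 * sqrt q * sqrt p\<close> of the
      expanded square, after multiplication by \<open>2 * q\<close>.\<close>
    have "ln (p / q) / 2 \<le> sqrt (p / q) - 1"
      using ln_le_minus_one[of "sqrt (p / q)"] that q by (simp add: ln_sqrt)
    then have "q * (2 - 2 * sqrt (p / q)) \<le> q * ln (q / p)"
      using that q by (intro mult_left_mono) (auto simp: ln_div)
    moreover have "q * sqrt (p / q) = sqrt q * sqrt p"
      using that q by (simp add: real_sqrt_divide field_simps)
    ultimately show ?thesis
      using that q by (simp add: power2_diff algebra_simps)
  qed (use that in simp)
  have "(\<Sum>\<sigma>\<in>\<Omega>. (sqrt (pmf \<nu> \<sigma>) - sqrt (pmf \<mu> \<sigma>))\<^sup>2)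
      \<le> (\<Sum>\<sigma>\<in>\<Omega>. pmf \<nu> \<sigma> / pmf \<mu> \<sigma> * ln (pmf \<nu> \<sigma> / pmf \<mu> \<sigma>) * pmf \<mu> \<sigma> - pmf \<nu> \<sigma> + pmf \<mu> \<sigma>)"
    using \<mu> by (intro sum_mono pointwise) (auto simp: pmf_positive_iff)
  also have "\<dots> = (\<Sum>\<sigma>\<in>\<Omega>. pmf \<nu> \<sigma> / pmf \<mu> \<sigma> * ln (pmf \<nu> \<sigma> / pmf \<mu> \<sigma>) * pmf \<mu> \<sigma>)"
    using assms by (simp add: sum.distrib sum_subtractf sum_pmf_eq_1)
  also have "\<dots> = entropy_pmf \<mu> (\<lambda>\<sigma>. pmf \<nu> \<sigma> / pmf \<mu> \<sigma>)"
    unfolding entropy_pmf_def expectation_density[OF assms]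
    using fin \<mu> by (subst integral_measure_pmf_real[of \<Omega>]) auto
  finally show ?thesis
    unfolding hellinger_dist_def by simp
qed

section \<open>Gibbs measures, their densities, and oscillations\<close>

lemma set_pmf_gibbs:
  assumes "finite V" "s \<ge> 1"
  shows "set_pmf (gibbs s V H) = configs s V"
proof -
  have "(\<Sum>\<tau> \<in> configs s V. exp (H \<tau>)) > 0"
    using finite_configs[OF assms(1)] configs_nonempty[OF assms(2)] by (intro sum_pos) auto
  then show ?thesis
    by (auto simp: set_pmf_iff pmf_gibbs[OF assms] split: if_splits)
qed

text \<open>The two partition functions enter \<open>ln (F \<sigma>)\<close> only as additive
  constants and cancel in the difference, so their ratio never has to be estimated.\<close>

lemma gibbs_density_log_diff:
  fixes H h :: "('v \<Rightarrow> nat) \<Rightarrow> real"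
  assumes "finite V" "s \<ge> 1" and \<sigma>: "\<sigma> \<in> configs s V" and \<tau>: "\<tau> \<in> configs s V"
  defines "F \<equiv> \<lambda>\<sigma>. pmf (gibbs s V (\<lambda>\<sigma>. H \<sigma> + h \<sigma>)) \<sigma> / pmf (gibbs s V H) \<sigma>"
  shows "ln (F \<sigma>) - ln (F \<tau>) = h \<sigma> - h \<tau>"
proof -
  let ?Z = "\<lambda>H. \<Sum>\<tau> \<in> configs s V. exp (H \<tau> :: real)"
  have Z: "?Z H > 0" for H
    using finite_configs[OF assms(1)] configs_nonempty[OF assms(2)] by (intro sum_pos) auto
  have "ln (F \<sigma>) = h \<sigma> + ln (?Z H) - ln (?Z (\<lambda>\<sigma>. H \<sigma> + h \<sigma>))" if "\<sigma> \<in> configs s V" for \<sigma>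
    using that Z[of H] Z[of "\<lambda>\<sigma>. H \<sigma> + h \<sigma>"]
    by (simp add: F_def pmf_gibbs[OF assms(1,2)] ln_div ln_mult)
  then show ?thesis using \<sigma> \<tau> by simp
qed

lemma abs_diff_le_half_osc:
  assumes "finite \<Omega>" "\<sigma> \<in> \<Omega>" "\<tau> \<in> \<Omega>"
  shows "\<bar>h \<sigma> - h \<tau>\<bar> \<le> 2 * half_osc \<Omega> h"
proof -
  have "h \<sigma> \<le> Sup (h ` \<Omega>)" "Inf (h ` \<Omega>) \<le> h \<sigma>" if "\<sigma> \<in> \<Omega>" for \<sigma>
    using assms(1) that by (auto intro: cSUP_upper cINF_lower)
  note this[OF assms(2)] this[OF assms(3)]
  moreover have "2 * half_osc \<Omega> h = Sup (h ` \<Omega>) - Inf (h ` \<Omega>)"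
    by (simp add: half_osc_def)
  ultimately show ?thesis by linarith
qed

lemma half_osc_nonneg:
  assumes "finite \<Omega>" "\<Omega> \<noteq> {}"
  shows "0 \<le> half_osc \<Omega> h"
  using assms abs_diff_le_half_osc[of \<Omega> _ _ h] by fastforce

section \<open>Counting incidences between vertices and factors\<close>

text \<open>Double counting of the pairs of a vertex and a factor whose scope contains it. The
  weights live in a general semiring because the identity serves both for real squares and for
  cardinalities in the natural numbers.\<close>

lemma sum_factors_at:
  fixes w :: "'i \<Rightarrow> 'b::comm_semiring_1"
  assumes "wf_factor_graph s G"
  shows "(\<Sum>x\<in>verts G. \<Sum>\<phi>\<in>factors_at G x. w \<phi>) = (\<Sum>\<phi>\<in>indices G. of_nat (card (scope G \<phi>)) * w \<phi>)"
proof -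
  have fin: "finite (verts G)" "finite (indices G)"
    and sub: "\<And>\<phi>. \<phi> \<in> indices G \<Longrightarrow> scope G \<phi> \<subseteq> verts G"
    using assms by (auto simp: wf_factor_graph_def)
  have "(\<Sum>x\<in>verts G. \<Sum>\<phi>\<in>factors_at G x. w \<phi>)
      = (\<Sum>\<phi>\<in>indices G. \<Sum>x | x \<in> verts G \<and> x \<in> scope G \<phi>. w \<phi>)"
    unfolding factors_at_def using fin by (rule sum.swap_restrict)
  also have "\<dots> = (\<Sum>\<phi>\<in>indices G. of_nat (card (scope G \<phi>)) * w \<phi>)"
  proof (rule sum.cong)
    fix \<phi> assume "\<phi> \<in> indices G"
    then have "{x. x \<in> verts G \<and> x \<in> scope G \<phi>} = scope G \<phi>" using sub by blast
    then show "(\<Sum>x | x \<in> verts G \<and> x \<in> scope G \<phi>. w \<phi>) = of_nat (card (scope G \<phi>)) * w \<phi>"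
      by simp
  qed simp
  finally show ?thesis .
qed

text \<open>Scopes are nonempty, so the sum of the vertex degrees counts every factor at least
  once.\<close>

lemma card_indices_le:
  assumes wf: "wf_factor_graph s G"
    and deg: "\<And>x. x \<in> verts G \<Longrightarrow> card (factors_at G x) \<le> \<Delta>"
  shows "card (indices G) \<le> card (verts G) * \<Delta>"
proof -
  have "card (scope G \<phi>) \<ge> 1" if "\<phi> \<in> indices G" for \<phi>
    using wf that by (auto simp: wf_factor_graph_def Suc_le_eq card_gt_0_iff intro: finite_subset)
  then have "card (indices G) \<le> (\<Sum>\<phi>\<in>indices G. card (scope G \<phi>))"
    using sum_mono[of "indices G" "\<lambda>_. 1" "\<lambda>\<phi>. card (scope G \<phi>)"] by simp
  also have "\<dots> = (\<Sum>x\<in>verts G. card (factors_at G x))"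
    using sum_factors_at[OF wf, of "\<lambda>_. 1 :: nat"] by simp
  also have "\<dots> \<le> card (verts G) * \<Delta>"
    using sum_mono[of "verts G" "\<lambda>x. card (factors_at G x)" "\<lambda>_. \<Delta>"] deg by simp
  finally show ?thesis .
qed

section \<open>Quantitative bound for a single factor graph\<close>

text \<open>A form without limits: the bound sees the graph only through \<Delta>, \<kappa>,
  \<open>C\<close> and \<open>T\<close>, and not through its number of vertices. This uniformity is
  what the passage to the limit needs.\<close>

lemma hellinger_dist_gibbs_le:
  fixes G :: "('v, 'i) factor_graph" and H :: "('v \<Rightarrow> nat) \<Rightarrow> real" and s :: nat
  defines "V \<equiv> verts G"
  defines "\<Omega> \<equiv> configs s V"
  assumes s: "s \<ge> 1"
    and wf: "wf_factor_graph s G"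
    and deg: "\<And>x. x \<in> V \<Longrightarrow> card (factors_at G x) \<le> \<Delta>"
    and scope: "\<And>\<phi>. \<phi> \<in> indices G \<Longrightarrow> card (scope G \<phi>) \<le> \<kappa>"
    and dep: "\<And>\<phi>. \<phi> \<in> indices G \<Longrightarrow> depends_only_on s V (scope G \<phi>) (g \<phi>)"
    and AT: "\<And>f. (\<And>\<sigma>. \<sigma> \<in> \<Omega> \<Longrightarrow> f \<sigma> \<ge> 0) \<Longrightarrow>
      entropy_pmf (gibbs s V H) f \<le> C * (\<Sum>x\<in>V. mean_local_entropy V (gibbs s V H) {x} f)"
  defines "T \<equiv> \<Sum>\<phi>\<in>indices G. (half_osc \<Omega> (g \<phi>))\<^sup>2"
  shows "hellinger_dist \<Omega> (gibbs s V (\<lambda>\<sigma>. H \<sigma> + (\<Sum>\<phi>\<in>indices G. g \<phi> \<sigma>))) (gibbs s V H)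
    \<le> sqrt (\<bar>C\<bar> * (exp (2 * sqrt (\<Delta> * T)) * (4 * real \<Delta> * real \<kappa> * T)))"
proof -
  let ?\<mu> = "gibbs s V H"
  let ?\<nu> = "gibbs s V (\<lambda>\<sigma>. H \<sigma> + (\<Sum>\<phi>\<in>indices G. g \<phi> \<sigma>))"
  let ?\<delta> = "\<lambda>\<phi>. half_osc \<Omega> (g \<phi>)"
  define F where "F = (\<lambda>\<sigma>. pmf ?\<nu> \<sigma> / pmf ?\<mu> \<sigma>)"
  define a where "a = (\<lambda>x. 2 * (\<Sum>\<phi>\<in>factors_at G x. ?\<delta> \<phi>))"
  define B where "B = exp (2 * sqrt (\<Delta> * T))"
  have V: "finite V" and ind: "finite (indices G)"
    using wf by (auto simp: wf_factor_graph_def V_def)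
  have \<Omega>: "finite \<Omega>" "\<Omega> \<noteq> {}"
    using V s by (auto simp: \<Omega>_def finite_configs configs_nonempty)
  have supp: "set_pmf ?\<mu> = \<Omega>" "set_pmf ?\<nu> = \<Omega>"
    using V s by (simp_all add: \<Omega>_def set_pmf_gibbs)
  have \<delta>: "?\<delta> \<phi> \<ge> 0" for \<phi> using \<Omega> by (rule half_osc_nonneg)
  have at: "factors_at G x \<subseteq> indices G" for x by (auto simp: factors_at_def)
  have F_pos: "F \<sigma> > 0" if "\<sigma> \<in> set_pmf ?\<mu>" for \<sigma>
    using that supp by (auto simp: F_def pmf_positive_iff)
  have osc: "\<bar>ln (F \<sigma>) - ln (F \<tau>)\<bar> \<le> a x"
    if mem: "\<sigma> \<in> set_pmf ?\<mu>" "\<tau> \<in> set_pmf ?\<mu>" and eq: "\<And>y. y \<notin> {x} \<Longrightarrow> \<sigma> y = \<tau> y" for \<sigma> \<tau> x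
  proof -
    have mem: "\<sigma> \<in> \<Omega>" "\<tau> \<in> \<Omega>" using mem supp by auto
    \<comment> \<open>A factor whose scope misses \<open>x\<close> has the same value at \<sigma>
      and \<tau>, since they agree on its entire scope.\<close>
    have zero: "g \<phi> \<sigma> - g \<phi> \<tau> = 0" if "\<phi> \<in> indices G - factors_at G x" for \<phi>
      using that dep[of \<phi>] mem eq unfolding depends_only_on_def factors_at_def \<Omega>_def
      by (smt (verit) DiffE mem_Collect_eq singletonD)
    have "ln (F \<sigma>) - ln (F \<tau>) = (\<Sum>\<phi>\<in>indices G. g \<phi> \<sigma> - g \<phi> \<tau>)"
      using gibbs_density_log_diff[OF V s, of \<sigma> \<tau> H "\<lambda>\<sigma>. \<Sum>\<phi>\<in>indices G. g \<phi> \<sigma>"] mem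
      by (simp add: F_def \<Omega>_def sum_subtractf)
    also have "\<dots> = (\<Sum>\<phi>\<in>factors_at G x. g \<phi> \<sigma> - g \<phi> \<tau>)"
      using ind at zero by (intro sum.mono_neutral_right) auto
    finally have "\<bar>ln (F \<sigma>) - ln (F \<tau>)\<bar> \<le> (\<Sum>\<phi>\<in>factors_at G x. \<bar>g \<phi> \<sigma> - g \<phi> \<tau>\<bar>)"
      by (simp only: sum_abs)
    also have "\<dots> \<le> a x"
      unfolding a_def sum_distrib_left using \<Omega>(1) mem by (intro sum_mono abs_diff_le_half_osc)
    finally show ?thesis .
  qed
  have a_sq: "(a x)\<^sup>2 \<le> 4 * \<Delta> * (\<Sum>\<phi>\<in>factors_at G x. (?\<delta> \<phi>)\<^sup>2)" if x: "x \<in> V" for x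
  proof -
    have "(\<Sum>\<phi>\<in>factors_at G x. ?\<delta> \<phi>)\<^sup>2 \<le> card (factors_at G x) * (\<Sum>\<phi>\<in>factors_at G x. (?\<delta> \<phi>)\<^sup>2)"
      using sum_squared_le_sum_of_squares[of ?\<delta> "factors_at G x"]
      by (simp only: mult.commute)
    also have "\<dots> \<le> \<Delta> * (\<Sum>\<phi>\<in>factors_at G x. (?\<delta> \<phi>)\<^sup>2)"
      using deg[OF x] by (intro mult_right_mono sum_nonneg) auto
    finally show ?thesis by (simp add: a_def power_mult_distrib)
  qed
  have T: "T \<ge> 0" by (simp add: T_def sum_nonneg)
  \<comment> \<open>The exponential needs a bound uniform in \<open>x\<close>. Crudely, the squared
    oscillations at one vertex are at most their total \<open>T\<close>.\<close>
  have a_le: "exp (a x) \<le> B" if x: "x \<in> V" for x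
  proof -
    have "(a x)\<^sup>2 \<le> 4 * \<Delta> * (\<Sum>\<phi>\<in>factors_at G x. (?\<delta> \<phi>)\<^sup>2)" by (rule a_sq[OF x])
    also have "\<dots> \<le> 4 * \<Delta> * T"
      unfolding T_def using ind at by (intro mult_left_mono sum_mono2) auto
    also have "\<dots> = (2 * sqrt (\<Delta> * T))\<^sup>2" using T by (simp add: power_mult_distrib)
    finally have "a x \<le> 2 * sqrt (\<Delta> * T)"
      using T by (intro power2_le_imp_le[of "a x"]) auto
    then show ?thesis by (simp add: B_def)
  qed
  have E: "measure_pmf.expectation ?\<mu> F = 1"
    unfolding F_def using \<Omega> supp by (intro expectation_density) auto
  have local: "0 \<le> mean_local_entropy V ?\<mu> {x} F" "mean_local_entropy V ?\<mu> {x} F \<le> B * (a x)\<^sup>2"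
    if x: "x \<in> V" for x
  proof -
    have "{x} \<subseteq> V" "set_pmf ?\<mu> \<subseteq> configs s V" using x supp by (auto simp: \<Omega>_def)
    note mle = mean_local_entropy_le[OF V this, of F "a x", OF F_pos osc, unfolded E]
    show "0 \<le> mean_local_entropy V ?\<mu> {x} F" by (rule mle(1)) auto
    have "mean_local_entropy V ?\<mu> {x} F \<le> 1 * exp (a x) * (a x)\<^sup>2" by (rule mle(2)) auto
    also have "\<dots> \<le> B * (a x)\<^sup>2" using a_le[OF x] by (intro mult_right_mono) auto
    finally show "mean_local_entropy V ?\<mu> {x} F \<le> B * (a x)\<^sup>2" .
  qed
  have "(\<Sum>x\<in>V. mean_local_entropy V ?\<mu> {x} F)
      \<le> (\<Sum>x\<in>V. B * (4 * \<Delta> * (\<Sum>\<phi>\<in>factors_at G x. (?\<delta> \<phi>)\<^sup>2)))"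
    using a_sq by (intro sum_mono order.trans[OF local(2)] mult_left_mono) (auto simp: B_def)
  \<comment> \<open>Exchanging the sums counts each factor once per vertex of its scope, hence at
    most \<kappa> times.\<close>
  also have "\<dots> = B * (4 * \<Delta> * (\<Sum>\<phi>\<in>indices G. card (scope G \<phi>) * (?\<delta> \<phi>)\<^sup>2))"
    using sum_factors_at[OF wf, of "\<lambda>\<phi>. (?\<delta> \<phi>)\<^sup>2"] by (simp add: V_def flip: sum_distrib_left)
  also have "\<dots> \<le> B * (4 * \<Delta> * (\<kappa> * T))"
    unfolding T_def sum_distrib_left[of "real \<kappa>"] using scope
    by (intro mult_left_mono sum_mono mult_right_mono) (auto simp: B_def)
  finally have total: "(\<Sum>x\<in>V. mean_local_entropy V ?\<mu> {x} F) \<le> B * (4 * real \<Delta> * real \<kappa> * T)"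
    by (simp add: mult.assoc)
  have "entropy_pmf ?\<mu> F \<le> C * (\<Sum>x\<in>V. mean_local_entropy V ?\<mu> {x} F)"
    by (rule AT) (simp add: F_def)
  \<comment> \<open>The sign of \<open>C\<close> is not prescribed; nonnegativity of the local
    entropies permits passing to its absolute value.\<close>
  also have "\<dots> \<le> \<bar>C\<bar> * (\<Sum>x\<in>V. mean_local_entropy V ?\<mu> {x} F)"
    using local(1) by (intro mult_right_mono sum_nonneg) auto
  also have "\<dots> \<le> \<bar>C\<bar> * (B * (4 * real \<Delta> * real \<kappa> * T))"
    using total by (intro mult_left_mono) auto
  finally have "sqrt (entropy_pmf ?\<mu> F) \<le> sqrt (\<bar>C\<bar> * (B * (4 * real \<Delta> * real \<kappa> * T)))"
    by simp
  moreover have "hellinger_dist \<Omega> ?\<nu> ?\<mu> \<le> sqrt (entropy_pmf ?\<mu> F)"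
    unfolding F_def using \<Omega> supp by (intro hellinger_dist_le_entropy) auto
  ultimately show ?thesis unfolding B_def by (rule order.trans[rotated])
qed

section \<open>Limits along the sequence of graphs\<close>

text \<open>Inserting 0 gives \<open>Max\<close> a value when the index set is empty, and changes
  nothing otherwise because \<open>d\<close> is nonnegative.\<close>

lemma sum_power2_le_card_Max:
  fixes d :: "'i \<Rightarrow> real"
  assumes "finite I" "\<And>i. i \<in> I \<Longrightarrow> 0 \<le> d i"
  shows "(\<Sum>i\<in>I. (d i)\<^sup>2) \<le> card I * (Max (insert 0 (d ` I)))\<^sup>2"
  using assms by (intro sum_bounded_above power_mono Max_ge) auto

theorem corollary3p2:
  fixes s \<Delta> \<kappa> :: nat
    and C\<^sub>A\<^sub>T :: real
    and G :: "nat \<Rightarrow> (nat, 'i) factor_graph"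
    and g :: "nat \<Rightarrow> 'i \<Rightarrow> (nat \<Rightarrow> nat) \<Rightarrow> real"
    and \<Omega> :: "nat \<Rightarrow> (nat \<Rightarrow> nat) set"
    and \<mu> \<nu> :: "nat \<Rightarrow> (nat \<Rightarrow> nat) pmf"
    and \<delta> :: "nat \<Rightarrow> 'i \<Rightarrow> real"
  defines "\<Omega> \<equiv> \<lambda>n. configs s {1..n}"
    and "\<mu> \<equiv> \<lambda>n. gibbs s {1..n} (\<lambda>\<sigma>. \<Sum>\<phi> \<in> indices (G n). factor (G n) \<phi> \<sigma>)"
    and "\<nu> \<equiv> \<lambda>n. gibbs s {1..n} (\<lambda>\<sigma>. (\<Sum>\<phi> \<in> indices (G n). factor (G n) \<phi> \<sigma>)
                                    + (\<Sum>\<phi> \<in> indices (G n). g n \<phi> \<sigma>))"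
    and "\<delta> \<equiv> \<lambda>n \<phi>. half_osc (\<Omega> n) (g n \<phi>)"
  assumes s: "s \<ge> 1"
    and graph: "\<And>n. n \<ge> 1 \<Longrightarrow> wf_factor_graph s (G n)"
    and verts: "\<And>n. n \<ge> 1 \<Longrightarrow> verts (G n) = {1..n}"
    and degree: "\<And>n x. n \<ge> 1 \<Longrightarrow> x \<in> {1..n} \<Longrightarrow> card (factors_at (G n) x) \<le> \<Delta>"
    and scope_size: "\<And>n \<phi>. n \<ge> 1 \<Longrightarrow> \<phi> \<in> indices (G n) \<Longrightarrow> card (scope (G n) \<phi>) \<le> \<kappa>"
    and perturbation: "\<And>n \<phi>. n \<ge> 1 \<Longrightarrow> \<phi> \<in> indices (G n) \<Longrightarrow>
                  depends_only_on s {1..n} (scope (G n) \<phi>) (g n \<phi>)"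
    and tensorization: "\<And>n f. n \<ge> 1 \<Longrightarrow> (\<And>\<sigma>. \<sigma> \<in> \<Omega> n \<Longrightarrow> f \<sigma> \<ge> 0) \<Longrightarrow>
                  entropy_pmf (\<mu> n) f \<le> C\<^sub>A\<^sub>T * (\<Sum>x \<in> {1..n}. mean_local_entropy {1..n} (\<mu> n) {x} f)"
  shows "((\<lambda>n. \<Sum>\<phi> \<in> indices (G n). (\<delta> n \<phi>)\<^sup>2) \<longlonglongrightarrow> 0
            \<longrightarrow> (\<lambda>n. hellinger_dist (\<Omega> n) (\<nu> n) (\<mu> n)) \<longlonglongrightarrow> 0)
       \<and> ((\<lambda>n. Max (insert 0 (\<delta> n ` indices (G n)))) \<in> o(\<lambda>n. real n powr (- 1 / 2))
            \<longrightarrow> (\<lambda>n. \<Sum>\<phi> \<in> indices (G n). (\<delta> n \<phi>)\<^sup>2) \<longlonglongrightarrow> 0)"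
proof (intro conjI impI)
  let ?T = "\<lambda>n. \<Sum>\<phi> \<in> indices (G n). (\<delta> n \<phi>)\<^sup>2"
  let ?M = "\<lambda>n. Max (insert 0 (\<delta> n ` indices (G n)))"
  {
    assume T: "?T \<longlonglongrightarrow> 0"
    let ?b = "\<lambda>n. sqrt (\<bar>C\<^sub>A\<^sub>T\<bar> * (exp (2 * sqrt (\<Delta> * ?T n)) * (4 * real \<Delta> * real \<kappa> * ?T n)))"
    \<comment> \<open>The bound is a continuous function of \<open>?T n\<close>, with coefficients
      independent of \<open>n\<close>, and it vanishes at zero.\<close>
    have "?b \<longlonglongrightarrow> sqrt (\<bar>C\<^sub>A\<^sub>T\<bar> * (exp (2 * sqrt (real \<Delta> * 0)) * (4 * real \<Delta> * real \<kappa> * 0)))"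
      by (intro tendsto_intros T)
    then have b: "?b \<longlonglongrightarrow> 0" by simp
    have "hellinger_dist (\<Omega> n) (\<nu> n) (\<mu> n) \<le> ?b n" if n: "n \<ge> 1" for n
      using hellinger_dist_gibbs_le[OF s graph[OF n], where g = "g n" and \<Delta> = \<Delta> and \<kappa> = \<kappa> and C = "C\<^sub>A\<^sub>T"
          and H = "\<lambda>\<sigma>. \<Sum>\<phi> \<in> indices (G n). factor (G n) \<phi> \<sigma>", unfolded verts[OF n],
          OF degree[OF n] scope_size[OF n] perturbation[OF n]
          tensorization[OF n, unfolded \<Omega>_def \<mu>_def]]
      unfolding \<Omega>_def \<mu>_def \<nu>_def \<delta>_def by blast
    then have "\<forall>\<^sub>F n in sequentially. hellinger_dist (\<Omega> n) (\<nu> n) (\<mu> n) \<le> ?b n"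
      by (auto simp: eventually_sequentially)
    moreover have "\<forall>\<^sub>F n in sequentially. 0 \<le> hellinger_dist (\<Omega> n) (\<nu> n) (\<mu> n)"
      by (simp add: hellinger_dist_def sum_nonneg)
    ultimately show "(\<lambda>n. hellinger_dist (\<Omega> n) (\<nu> n) (\<mu> n)) \<longlonglongrightarrow> 0"
      by (rule tendsto_sandwich[OF _ _ tendsto_const b, rotated])
  }
  assume small: "?M \<in> o(\<lambda>n. real n powr (- 1 / 2))"
  have "(\<lambda>n. ?M n / real n powr (- 1 / 2)) \<longlonglongrightarrow> 0"
    using small by (rule smalloD_tendsto)
  \<comment> \<open>The square of the quotient is \<open>n * (?M n)\<^sup>2\<close> for positive
    \<open>n\<close>. With the factor \<Delta> this is the bound \<open>n * \<Delta>\<close> on the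
    number of factors times the largest squared oscillation, so it dominates
    \<open>?T n\<close>.\<close>
  then have "(\<lambda>n. \<Delta> * (?M n / real n powr (- 1 / 2))\<^sup>2) \<longlonglongrightarrow> real \<Delta> * 0\<^sup>2"
    by (intro tendsto_intros)
  then have lim: "(\<lambda>n. \<Delta> * (?M n / real n powr (- 1 / 2))\<^sup>2) \<longlonglongrightarrow> 0" by simp
  have "?T n \<le> \<Delta> * (?M n / real n powr (- 1 / 2))\<^sup>2" if n: "n \<ge> 1" for n
  proof -
    have "\<delta> n \<phi> \<ge> 0" for \<phi>
      unfolding \<delta>_def \<Omega>_def using s by (intro half_osc_nonneg finite_configs configs_nonempty) auto
    then have "?T n \<le> card (indices (G n)) * (?M n)\<^sup>2"
      using graph[OF n] by (intro sum_power2_le_card_Max) (auto simp: wf_factor_graph_def)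
    also have "\<dots> \<le> real (n * \<Delta>) * (?M n)\<^sup>2"
      using card_indices_le[OF graph[OF n], of \<Delta>] verts[OF n] degree[OF n]
      by (intro mult_right_mono of_nat_mono) auto
    also have "real (n * \<Delta>) = \<Delta> / (real n powr (- 1 / 2))\<^sup>2"
      using n by (simp add: powr_minus_divide powr_half_sqrt power_divide)
    finally show ?thesis by (simp add: power_divide)
  qed
  then have "\<forall>\<^sub>F n in sequentially. ?T n \<le> \<Delta> * (?M n / real n powr (- 1 / 2))\<^sup>2"
    by (auto simp: eventually_sequentially)
  moreover have "\<forall>\<^sub>F n in sequentially. 0 \<le> ?T n"
    by (simp add: sum_nonneg)
  ultimately show "?T \<longlonglongrightarrow> 0"
    by (rule tendsto_sandwich[OF _ _ tendsto_const lim, rotated])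
qed

end
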